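(* Let $n\ge 1$ and $k,l,m$ be integers with $\gcd(k,l,m,n)=1$, and let $\Delta(n;k,l,m)$ be the $\Delta$-graph defined in the context. Let $I=I_n$ be the $n\times n$ identity matrix and $T=\mathrm{circ}(0,1,0,\ldots,0)$ the $n\times n$ cyclic shift matrix. Put $A=4I-T^{k}-T^{-k}$, $B=4I-T^{l}-T^{-l}$, $C=4I-T^{m}-T^{-m}$, and let $M$ be the $2n\times 2n$ integer block matrix $$M=\begin{pmatrix} -I-A & I+B\\ -I+CA & -I-C\end{pmatrix}.$$ Then the Jacobian group $\mathrm{Jac}(\Delta(n;k,l,m))$ is isomorphic to the torsion subgroup of $\mathrm{coker}(M)=\mathbb{Z}^{2n}/M\mathbb{Z}^{2n}$.
   Context: The $\Delta$-graph $\Delta(n;k,l,m)$ has $3n$ vertices $v_{x,y}$, $x\in\{1,2,3\}$, $y\in\mathbb{Z}/n\mathbb{Z}$. For each fixed $x$, each $v_{x,y}$ is joined to $v_{x,y+j(x)}$, where $j(1)=k$, $j(2)=l$, $j(3)=m$ (indices mod $n$); for each fixed $y$, the three vertices $v_{1,y},v_{2,y},v_{3,y}$ form a triangle. The graph is connected when $\gcd(k,l,m,n)=1$. With vertices ordered in three blocks by $x$, its Laplacian matrix $L=D-A(G)$ (degree matrix minus adjacency matrix) is the $3n\times 3n$ block matrix $L=\begin{pmatrix} A&-I&-I\\-I&B&-I\\-I&-I&C\end{pmatrix}$ with $A,B,C$ as in the claim. For an integer square matrix $N$ of size $r$, $\mathrm{coker}(N)=\mathbb{Z}^r/N\mathbb{Z}^r$.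 The Jacobian group $\mathrm{Jac}(G)$ of a connected graph $G$ is the torsion subgroup of $\mathrm{coker}(L(G))$. The matrix $\mathrm{circ}(a_0,\ldots,a_{n-1})$ is the circulant matrix whose first row is $(a_0,\ldots,a_{n-1})$ and each subsequent row is the previous one shifted cyclically one step to the right. *)

theory Defs
  imports "Jordan_Normal_Form.Matrix" "HOL-Algebra.Coset" "HOL-Library.Multiset"
begin

(* Undirected multigraphs; loops are allowed.  The ends of an edge form a two-element
   multiset, {#u, v#}, so that a loop at v has ends {#v, v#}. *)
record ('v, 'e) multigraph =
  verts :: "'v set"
  edges :: "'e set"
  ends :: "'e \<Rightarrow> 'v multiset"

definition degree :: "('v, 'e) multigraph \<Rightarrow> 'v \<Rightarrow> nat" where
  "degree G v = (\<Sum>e\<in>edges G. count (ends G e) v)"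

(* A loop counts twice both in the degree and on the diagonal of the adjacency matrix,
   so that it contributes nothing to the Laplacian. *)
definition adjacency :: "('v, 'e) multigraph \<Rightarrow> 'v \<Rightarrow> 'v \<Rightarrow> nat" where
  "adjacency G u v = (if u = v then 2 else 1) * card {e \<in> edges G. ends G e = {#u, v#}}"

(* In the matrices below vs is an enumeration of the vertex set without repetition. *)
definition degree_mat :: "('v, 'e) multigraph \<Rightarrow> 'v list \<Rightarrow> int mat" where
  "degree_mat G vs = mat (length vs) (length vs)
     (\<lambda>(i, j). if i = j then int (degree G (vs ! i)) else 0)"

definition adjacency_mat :: "('v, 'e) multigraph \<Rightarrow> 'v list \<Rightarrow> int mat" where
  "adjacency_mat G vs = mat (length vs) (length vs)
     (\<lambda>(i, j). int (adjacency G (vs ! i) (vs ! j)))"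

definition laplacian_mat :: "('v, 'e) multigraph \<Rightarrow> 'v list \<Rightarrow> int mat" where
  "laplacian_mat G vs = degree_mat G vs - adjacency_mat G vs"

(* For square N of size r this is the group of cosets of N Z^r in the additive group Z^r. *)
definition coker :: "int mat \<Rightarrow> int vec set monoid" where
  "coker N = monoid_vec TYPE(int) (dim_row N) Mod ((\<lambda>v. N *\<^sub>v v) ` carrier_vec (dim_col N))"

definition torsion_subgroup :: "('a, 'b) monoid_scheme \<Rightarrow> ('a, 'b) monoid_scheme" where
  "torsion_subgroup G =
     G\<lparr>carrier := {a \<in> carrier G. \<exists>d::nat. d > 0 \<and> a [^]\<^bsub>G\<^esub> d = \<one>\<^bsub>G\<^esub>}\<rparr>"

definition jacobian :: "('v, 'e) multigraph \<Rightarrow> 'v list \<Rightarrow> int vec set monoid" where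
  "jacobian G vs = torsion_subgroup (coker (laplacian_mat G vs))"

(* Cyc x y joins v_{x,y} to v_{x,y+j(x)}; Tri x x' y joins v_{x,y} to v_{x',y}.
   If 2j(x) is 0 mod n, the edges Cyc x y and Cyc x (y+j(x)) are parallel but distinct. *)
datatype delta_edge = Cyc nat int | Tri nat nat int

definition delta_step :: "int \<Rightarrow> int \<Rightarrow> int \<Rightarrow> nat \<Rightarrow> int" where
  "delta_step k l m x = (if x = 1 then k else if x = 2 then l else m)"

(* The class of y in Z/nZ is represented by its residue in {0..<n}. *)
fun delta_ends :: "nat \<Rightarrow> int \<Rightarrow> int \<Rightarrow> int \<Rightarrow> delta_edge \<Rightarrow> (nat \<times> int) multiset" where
  "delta_ends n k l m (Cyc x y) = {#(x, y), (x, (y + delta_step k l m x) mod int n)#}"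
| "delta_ends n k l m (Tri x x' y) = {#(x, y), (x', y)#}"

definition delta_graph ::
    "nat \<Rightarrow> int \<Rightarrow> int \<Rightarrow> int \<Rightarrow> (nat \<times> int, delta_edge) multigraph" where
  "delta_graph n k l m =
     \<lparr>verts = {1, 2, 3} \<times> {0..<int n},
      edges = (\<Union>y\<in>{0..<int n}. {Cyc 1 y, Cyc 2 y, Cyc 3 y, Tri 1 2 y, Tri 1 3 y, Tri 2 3 y}),
      ends = delta_ends n k l m\<rparr>"

definition delta_vertices :: "nat \<Rightarrow> (nat \<times> int) list" where
  "delta_vertices n = List.product [1, 2, 3] (map int [0..<n])"

definition circ :: "int list \<Rightarrow> int mat" where
  "circ a = mat (length a) (length a) (\<lambda>(i, j). a ! nat ((int j - int i) mod int (length a)))"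

(* circ(0,1,0,...,0) of size n.  The index 1 is read mod n: for n = 1 the cyclic shift is
   the 1x1 identity matrix. *)
definition shift_mat :: "nat \<Rightarrow> int mat" where
  "shift_mat n = circ (map (\<lambda>i. if i = 1 mod n then 1 else 0) [0..<n])"

(* Integer powers, with the inverse taken in the ring of n x n integer matrices. *)
definition mat_int_pow :: "nat \<Rightarrow> int mat \<Rightarrow> int \<Rightarrow> int mat" where
  "mat_int_pow n X j = X [^]\<^bsub>ring_mat TYPE(int) n ()\<^esub> j"

lemma set_delta_vertices: "set (delta_vertices n) = verts (delta_graph n k l m)"
  by (simp only: delta_vertices_def delta_graph_def set_product multigraph.simps list.set
      set_map set_upt image_int_atLeastLessThan of_nat_0)

lemma distinct_delta_vertices: "distinct (delta_vertices n)"
  unfolding delta_vertices_def by (rule distinct_product) (simp_all add: distinct_map)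

end

(* Number the three blocks so that the Laplacian has rows (A, -I, -I), (-I, B, -I), (-I, -I, C).
   The map (p, q, r) -> (q - p, r + C p) from Z^3n onto Z^2n has as kernel the span of the last
   block of columns, and it sends the first two blocks of columns to the columns of M.
   So it induces an isomorphism of cokernels. *)
theory Submission
  imports Defs
begin

section \<open>Torsion subgroups and cokernels\<close>

text \<open>A homomorphism preserves the equation \<open>a^d = 1\<close>, and an injective one also
  reflects it with the same d. So \<open>h\<close> restricts to a bijection between the torsion
  elements.\<close>

lemma torsion_subgroup_iso:
  assumes "group G" "group H" "G \<cong> H"
  shows "torsion_subgroup G \<cong> torsion_subgroup H"
proof -
  obtain h where h: "h \<in> iso G H"
    using assms(3) by (auto simp: is_iso_def)
  then have hom: "h \<in> hom G H" and img: "h ` carrier G = carrier H"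
    and inj: "inj_on h (carrier G)"
    by (auto simp: iso_iff)
  interpret G: group G by fact
  interpret H: group H by fact
  interpret group_hom G H h
    by unfold_locales (fact hom)
  have tors: "h x [^]\<^bsub>H\<^esub> d = \<one>\<^bsub>H\<^esub> \<longleftrightarrow> x [^]\<^bsub>G\<^esub> d = \<one>\<^bsub>G\<^esub>"
    if "x \<in> carrier G" for x and d :: nat
    using that inj hom_nat_pow[of x d] by (metis G.nat_pow_closed G.one_closed hom_one inj_onD)
  let ?T = "\<lambda>G. {a \<in> carrier G. \<exists>d::nat. d > 0 \<and> a [^]\<^bsub>G\<^esub> d = \<one>\<^bsub>G\<^esub>}"
  have "?T H = h ` ?T G"
    by (auto simp: tors simp flip: img intro!: imageI)
  then have "bij_betw h (?T G) (?T H)"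
    unfolding bij_betw_def using inj by (auto intro: inj_on_subset)
  moreover have "h \<in> hom (torsion_subgroup G) (torsion_subgroup H)"
    using hom by (auto simp: hom_def torsion_subgroup_def tors)
  ultimately have "h \<in> iso (torsion_subgroup G) (torsion_subgroup H)"
    by (simp add: iso_def torsion_subgroup_def)
  then show ?thesis
    by (rule is_isoI)
qed

section \<open>Cokernels of integer matrices and their isomorphisms\<close>

definition mat_range :: "int mat \<Rightarrow> int vec set" where
  "mat_range N = (\<lambda>v. N *\<^sub>v v) ` carrier_vec (dim_col N)"

text \<open>As the image of a group homomorphism this is a subgroup, and the ambient group is
  abelian. Normality makes the cokernel a group.\<close>

lemma normal_mat_range: "normal (mat_range N) (monoid_vec TYPE(int) (dim_row N))"
proof -
  let ?G = "monoid_vec TYPE(int) (dim_row N)" and ?D = "monoid_vec TYPE(int) (dim_col N)"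
  interpret G: comm_group ?G by (rule comm_group_vec)
  interpret D: comm_group ?D by (rule comm_group_vec)
  interpret group_hom ?D ?G "\<lambda>v. N *\<^sub>v v"
    by unfold_locales
      (auto simp: hom_def monoid_vec_simps mult_add_distrib_mat_vec[of N "dim_row N" "dim_col N"]
        intro!: carrier_vecI)
  have "subgroup (mat_range N) ?G"
    using img_is_subgroup by (simp add: mat_range_def monoid_vec_simps)
  then show ?thesis
    by (rule G.subgroup_imp_normal)
qed

lemma coker_eq: "coker N = monoid_vec TYPE(int) (dim_row N) Mod mat_range N"
  by (simp add: coker_def mat_range_def)

lemma group_coker: "group (coker N)"
  unfolding coker_eq by (rule normal.factorgroup_is_group[OF normal_mat_range])

text \<open>First isomorphism theorem for \<open>f\<close> followed by the projection onto
  \<open>coker M\<close>: surjectivity of \<open>f\<close> makes the composite onto, and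
  \<open>ker\<close> says that its kernel is exactly the range of \<open>L\<close>. The map
  \<open>f\<close> itself may have a nonzero kernel, as it does below.\<close>

lemma coker_iso:
  assumes hom: "f \<in> hom (monoid_vec TYPE(int) (dim_row L)) (monoid_vec TYPE(int) (dim_row M))"
    and surj: "f ` carrier_vec (dim_row L) = carrier_vec (dim_row M)"
    and ker: "\<And>v. v \<in> carrier_vec (dim_row L) \<Longrightarrow> f v \<in> mat_range M \<longleftrightarrow> v \<in> mat_range L"
  shows "coker L \<cong> coker M"
proof -
  let ?G = "monoid_vec TYPE(int) (dim_row L)" and ?H = "monoid_vec TYPE(int) (dim_row M)"
  let ?h = "(\<lambda>w. mat_range M #>\<^bsub>?H\<^esub> w) \<circ> f"
  interpret G: comm_group ?G by (rule comm_group_vec)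
  interpret N: normal "mat_range M" ?H by (rule normal_mat_range)
  interpret R: normal "mat_range L" ?G by (rule normal_mat_range)
  interpret Q: group "coker M" by (rule group_coker)
  have "?h \<in> hom ?G (coker M)"
    unfolding coker_eq by (rule hom_compose[OF hom N.r_coset_hom_Mod])
  then interpret h: group_hom ?G "coker M" ?h
    by unfold_locales
  have img: "?h ` carrier ?G = carrier (coker M)"
    unfolding image_comp[symmetric] by (auto simp: surj coker_eq FactGroup_def RCOSETS_def monoid_vec_simps)
  have "?h v = \<one>\<^bsub>coker M\<^esub> \<longleftrightarrow> v \<in> mat_range L" if "v \<in> carrier ?G" for v
  proof -
    have v: "v \<in> carrier_vec (dim_row L)"
      using that by (simp add: monoid_vec_simps)
    then have "f v \<in> carrier ?H"
      using surj by (auto simp: monoid_vec_simps)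
    then have "mat_range M #>\<^bsub>?H\<^esub> f v = mat_range M \<longleftrightarrow> f v \<in> mat_range M"
      using N.coset_join1[of "mat_range M"] N.coset_join2 N.subgroup_axioms by blast
    then show ?thesis
      by (simp add: coker_eq ker[OF v])
  qed
  then have "kernel ?G (coker M) ?h = mat_range L"
    using R.subset by (auto simp: kernel_def)
  then show ?thesis
    using h.FactGroup_iso[OF img] by (simp add: coker_eq[of L])
qed

section \<open>Powers of the cyclic shift\<close>

text \<open>The permutation matrix of the translation by j on Z/nZ: a closed form of
  \<open>T^j\<close> for every integer j, negative ones included.\<close>

definition shift_pow :: "nat \<Rightarrow> int \<Rightarrow> int mat" where
  "shift_pow n j = mat n n (\<lambda>(a, b). of_bool ((int a + j) mod int n = int b))"

lemma shift_pow_carrier: "shift_pow n j \<in> carrier_mat n n"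
  by (simp add: shift_pow_def)

lemma shift_pow_0: "shift_pow n 0 = 1\<^sub>m n"
  by (rule eq_matI) (auto simp: shift_pow_def)

lemma shift_pow_add: "shift_pow n i * shift_pow n j = shift_pow n (i + j)"
proof (rule eq_matI)
  fix a b assume "a < dim_row (shift_pow n (i + j))" "b < dim_col (shift_pow n (i + j))"
  then have a: "a < n" and b: "b < n"
    by (simp_all add: shift_pow_def)
  \<comment> \<open>The only column in which row a of the left factor is nonzero; the sum over h
    collapses to h = c.\<close>
  define c where "c = nat ((int a + i) mod int n)"
  have c: "int c = (int a + i) mod int n" "c < n"
    using a by (simp_all add: c_def nat_less_iff)
  have "(shift_pow n i * shift_pow n j) $$ (a, b) =
      (\<Sum>h\<in>{0..<n}. of_bool (h = c) * of_bool ((int h + j) mod int n = int b))"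
    using a b by (auto simp: shift_pow_def scalar_prod_def c(1)[symmetric] intro!: sum.cong)
  also have "\<dots> = (\<Sum>h\<in>{0..<n}. if h = c then of_bool ((int c + j) mod int n = int b) else 0)"
    by (rule sum.cong) auto
  also have "\<dots> = of_bool ((int c + j) mod int n = int b)"
    using c(2) by simp
  also have "\<dots> = shift_pow n (i + j) $$ (a, b)"
    using a b by (simp add: shift_pow_def c(1) mod_add_left_eq add.assoc)
  finally show "(shift_pow n i * shift_pow n j) $$ (a, b) = shift_pow n (i + j) $$ (a, b)" .
qed (simp_all add: shift_pow_def)

lemma shift_mat_eq: "shift_mat n = shift_pow n 1"
proof (rule eq_matI)
  fix a b assume "a < dim_row (shift_pow n 1)" "b < dim_col (shift_pow n 1)"
  then have a: "a < n" and b: "b < n"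
    by (simp_all add: shift_pow_def)
  \<comment> \<open>Both congruences say that n divides b - a - 1, up to sign. Keeping 1 reduced mod
    n covers n = 1, where the entry 1 of the circulant sits at index 0.\<close>
  have "(int b - int a) mod int n = 1 mod int n \<longleftrightarrow> (int a + 1) mod int n = int b mod int n"
    unfolding mod_eq_dvd_iff by (metis diff_diff_add dvd_minus_iff minus_diff_eq)
  moreover have "nat ((int b - int a) mod int n) < n"
    using a by (simp add: nat_less_iff)
  moreover have "nat ((int b - int a) mod int n) = 1 mod n \<longleftrightarrow>
      (int b - int a) mod int n = 1 mod int n"
    using a by (auto simp: nat_eq_iff zmod_int)
  ultimately show "shift_mat n $$ (a, b) = shift_pow n 1 $$ (a, b)"
    using a b by (simp add: shift_mat_def circ_def shift_pow_def)
qed (simp_all add: shift_mat_def circ_def shift_pow_def)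

text \<open>The addition law gives the natural powers by induction and shows that translation by -i
  inverts translation by i, which gives the negative powers.\<close>

lemma mat_int_pow_shift: "mat_int_pow n (shift_mat n) j = shift_pow n j"
proof -
  let ?R = "ring_mat TYPE(int) n ()"
  interpret ring ?R by (rule ring_mat)
  have nat: "shift_pow n 1 [^]\<^bsub>?R\<^esub> d = shift_pow n (int d)" for d :: nat
    by (induction d) (simp_all add: shift_pow_0 shift_pow_add ring_mat_simps add.commute)
  have inv: "inv\<^bsub>?R\<^esub> shift_pow n i = shift_pow n (- i)" for i
    by (rule inv_unique'[symmetric])
      (simp_all add: ring_mat_simps shift_pow_carrier shift_pow_add shift_pow_0)
  show ?thesis
    by (simp add: mat_int_pow_def shift_mat_eq int_pow_def2 nat inv)
qed

section \<open>The Laplacian of the graph\<close>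

text \<open>This is $L = Q Q^t$ for the signed incidence matrix $Q$; loops drop out.\<close>
lemma laplacian_mat_index:
  assumes fin: "finite (edges G)" and dist: "distinct vs"
    and ends: "\<And>e. e \<in> edges G \<Longrightarrow> ends G e = {#s e, t e#}"
    and i: "i < length vs" and j: "j < length vs"
  shows "laplacian_mat G vs $$ (i, j) =
    (\<Sum>e\<in>edges G. (of_bool (vs ! i = s e) - of_bool (vs ! i = t e)) *
      (of_bool (vs ! j = s e) - of_bool (vs ! j = t e)))"
proof -
  let ?u = "vs ! i" and ?v = "vs ! j"
  have ij: "i = j \<longleftrightarrow> ?u = ?v"
    using dist i j by (simp add: nth_eq_iff_index_eq)
  have "int (card {e \<in> edges G. ends G e = {#?u, ?v#}}) =
      (\<Sum>e\<in>edges G. of_bool (ends G e = {#?u, ?v#}))"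
    using fin by (simp add: of_bool_def sum.If_cases Int_def)
  then have "laplacian_mat G vs $$ (i, j) = (\<Sum>e\<in>edges G.
      (if ?u = ?v then int (count (ends G e) ?u) else 0)
        - (if ?u = ?v then 2 else 1) * of_bool (ends G e = {#?u, ?v#}))"
    using i j by (simp add: laplacian_mat_def degree_mat_def adjacency_mat_def degree_def
        adjacency_def ij sum_subtractf flip: sum_distrib_left)
  also have "\<dots> = (\<Sum>e\<in>edges G. (of_bool (?u = s e) - of_bool (?u = t e)) *
      (of_bool (?v = s e) - of_bool (?v = t e)))"
    \<comment> \<open>Edge by edge. If u = v, a non-loop at u counts 1, and a loop counts 2 - 2 = 0.
      If u and v differ, only an edge joining them contributes, namely -1.\<close>
    by (rule sum.cong) (auto simp: ends add_eq_conv_ex)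
  finally show ?thesis .
qed

text \<open>The edges y -> y + j on Z/NZ contribute the Laplacian \<open>2 I - T^j - T^(-j)\<close>.
  Expanding the product leaves four sums of products of Kronecker deltas. The formula stays right if
  j = 0 mod N (loops, total 0) or 2j = 0 mod N (parallel edges).\<close>

lemma sum_cyclic_edges:
  fixes N a b j :: int
  assumes a: "a \<in> {0..<N}" and b: "b \<in> {0..<N}"
  shows "(\<Sum>y\<in>{0..<N}. ((of_bool (a = y) :: int) - of_bool (a = (y + j) mod N)) *
      (of_bool (b = y) - of_bool (b = (y + j) mod N))) =
    2 * of_bool (a = b) - of_bool ((a + j) mod N = b) - of_bool ((a - j) mod N = b)"
    (is "?S = _")
proof -
  have shift: "c = (y + j) mod N \<longleftrightarrow> (c - j) mod N = y"
    if "c \<in> {0..<N}" "y \<in> {0..<N}" for c y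
  proof -
    have "c mod N = (y + j) mod N \<longleftrightarrow> (c - j) mod N = y mod N"
      unfolding mod_eq_dvd_iff by (simp add: algebra_simps)
    then show ?thesis
      using that by simp
  qed
  have N: "0 < N"
    using a by simp
  have delta: "(\<Sum>y\<in>{0..<N}. of_bool (c = y) * of_bool (d = y)) = (of_bool (c = d) :: int)"
    if "c \<in> {0..<N}" for c d
  proof -
    have "(\<Sum>y\<in>{0..<N}. of_bool (c = y) * of_bool (d = y)) =
        (\<Sum>y\<in>{0..<N}. if c = y then of_bool (d = c) else (0 :: int))"
      by (rule sum.cong) auto
    also have "\<dots> = of_bool (c = d)"
      using that by auto
    finally show ?thesis .
  qed
  \<comment> \<open>The residues at which the edges arriving at a and at b start; translation by j
    is invertible, so each is unique.\<close>
  define a' where "a' = (a - j) mod N"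
  define b' where "b' = (b - j) mod N"
  have mem: "a' \<in> {0..<N}" "b' \<in> {0..<N}"
    using N by (simp_all add: a'_def b'_def)
  have "?S = (\<Sum>y\<in>{0..<N}. of_bool (a = y) * of_bool (b = y) - of_bool (a = y) * of_bool (b' = y)
      - of_bool (a' = y) * of_bool (b = y) + of_bool (a' = y) * of_bool (b' = y))"
    using a b by (intro sum.cong) (auto simp: shift a'_def b'_def)
  also have "\<dots> = of_bool (a = b) - of_bool (a = b') - of_bool (a' = b) + of_bool (a' = b')"
    unfolding sum.distrib sum_subtractf using a b mem by (simp add: delta)
  also have "a' = b' \<longleftrightarrow> a = b"
    using a b by (metis a'_def b'_def diff_add_cancel mod_add_left_eq
        mod_pos_pos_trivial atLeastLessThan_iff)
  also have "a = b' \<longleftrightarrow> (a + j) mod N = b"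
    using shift[OF b a] by (auto simp: b'_def)
  finally show ?thesis
    by (simp add: a'_def)
qed

text \<open>Source and target fix an orientation of each edge, as the signed incidence matrix
  requires; the Laplacian does not depend on the choice.\<close>

fun delta_source :: "delta_edge \<Rightarrow> nat \<times> int" where
  "delta_source (Cyc x y) = (x, y)"
| "delta_source (Tri x x' y) = (x, y)"

fun delta_target :: "nat \<Rightarrow> int \<Rightarrow> int \<Rightarrow> int \<Rightarrow> delta_edge \<Rightarrow> nat \<times> int" where
  "delta_target n k l m (Cyc x y) = (x, (y + delta_step k l m x) mod int n)"
| "delta_target n k l m (Tri x x' y) = (x', y)"

lemma delta_ends_eq: "delta_ends n k l m e = {#delta_source e, delta_target n k l m e#}"
  by (cases e) simp_all

lemma length_delta_vertices: "length (delta_vertices n) = 3 * n"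
  by (simp add: delta_vertices_def)

text \<open>Blocks are counted from 0 while the labels x run from 1 to 3, hence the
  \<open>Suc\<close>.\<close>

lemma nth_delta_vertices:
  assumes "i < 3 * n"
  shows "delta_vertices n ! i = (Suc (i div n), int (i mod n))"
proof -
  have n: "0 < n"
    using assms by (cases n) auto
  then have "i div n < 3"
    using assms by (simp add: less_mult_imp_div_less)
  then have "i div n = 0 \<or> i div n = 1 \<or> i div n = 2"
    by linarith
  then have "[1, 2, 3] ! (i div n) = Suc (i div n)"
    by auto
  then show ?thesis
    using assms n by (simp only: delta_vertices_def) (simp add: product_nth del: List.product.simps)
qed

text \<open>The matrices A, B, C for j = k, l, m. Of the 4 on the diagonal, 2 comes from the cycle
  edges and 2 from the triangle.\<close>

definition delta_diag :: "nat \<Rightarrow> int \<Rightarrow> int mat" where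
  "delta_diag n j = 4 \<cdot>\<^sub>m 1\<^sub>m n - shift_pow n j - shift_pow n (- j)"

lemma delta_diag_carrier: "delta_diag n j \<in> carrier_mat n n"
  unfolding delta_diag_def by (intro minus_carrier_mat shift_pow_carrier)

text \<open>Addressing blocks by \<open>div\<close> and entries by \<open>mod\<close> matches the
  position of a vertex in \<open>delta_vertices\<close>.\<close>

definition three_block_mat :: "nat \<Rightarrow> (nat \<Rightarrow> nat \<Rightarrow> 'a mat) \<Rightarrow> 'a mat" where
  "three_block_mat n X = mat (3 * n) (3 * n) (\<lambda>(i, j). X (i div n) (j div n) $$ (i mod n, j mod n))"

text \<open>The edge sum is split by edge type. Cycle edges with label c only reach the diagonal
  block of c, where \<open>sum_cyclic_edges\<close> applies; the triangles contribute the Laplacian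
  of a triangle, with 2 on and -1 off the diagonal, at equal y.\<close>

lemma laplacian_delta_graph:
  "laplacian_mat (delta_graph n k l m) (delta_vertices n) =
    three_block_mat n (\<lambda>x x'. if x = x' then delta_diag n (delta_step k l m (Suc x)) else - 1\<^sub>m n)"
    (is "?L = ?R")
proof (rule eq_matI)
  fix i j assume "i < dim_row ?R" "j < dim_col ?R"
  then have i: "i < 3 * n" and j: "j < 3 * n"
    by (simp_all add: three_block_mat_def)
  then have n: "0 < n"
    by (cases n) auto
  define N where "N = int n"
  \<comment> \<open>The six edges with parameter y. These sets are disjoint for different y, so the
    sum over all edges becomes a double sum.\<close>
  define E where "E y = {Cyc 1 y, Cyc 2 y, Cyc 3 y, Tri 1 2 y, Tri 1 3 y, Tri 2 3 y}" for y
  define a where "a = int (i mod n)"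
  define b where "b = int (j mod n)"
  define x where "x = i div n"
  define x' where "x' = j div n"
  have ab: "a \<in> {0..<N}" "b \<in> {0..<N}"
    using n by (simp_all add: a_def b_def N_def)
  have "x < 3" "x' < 3"
    using i j n by (simp_all add: x_def x'_def less_mult_imp_div_less)
  then have x: "x = 0 \<or> x = 1 \<or> x = 2" "x' = 0 \<or> x' = 1 \<or> x' = 2"
    by linarith+
  define g :: "delta_edge \<Rightarrow> int" where "g e =
      (of_bool ((Suc x, a) = delta_source e) - of_bool ((Suc x, a) = delta_target n k l m e)) *
      (of_bool ((Suc x', b) = delta_source e) - of_bool ((Suc x', b) = delta_target n k l m e))" for e
  define w :: "nat \<Rightarrow> int" where "w c = 2 * of_bool (a = b)
    - of_bool ((a + delta_step k l m c) mod N = b) - of_bool ((a - delta_step k l m c) mod N = b)" for c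
  have cyc: "(\<Sum>y\<in>{0..<N}. g (Cyc c y)) = (if x = x' \<and> Suc x = c then w c else 0)" for c
  proof (cases "x = x' \<and> Suc x = c")
    case True
    then show ?thesis
      using sum_cyclic_edges[OF ab, of "delta_step k l m c"] by (simp add: g_def w_def N_def)
  next
    case False
    then show ?thesis
      \<comment> \<open>One of the two vertices has a label other than c, so its factor is 0 on
        every edge of the cycle class c.\<close>
      by (auto simp: g_def intro!: sum.neutral)
  qed
  have E: "edges (delta_graph n k l m) = (\<Union>y\<in>{0..<N}. E y)"
    by (simp add: delta_graph_def E_def N_def)
  have "?L $$ (i, j) = (\<Sum>e\<in>(\<Union>y\<in>{0..<N}. E y). g e)"
    using i j laplacian_mat_index[of "delta_graph n k l m" "delta_vertices n" delta_source
        "delta_target n k l m" i j]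
    by (simp add: E E_def delta_graph_def delta_ends_eq distinct_delta_vertices
        length_delta_vertices nth_delta_vertices g_def a_def b_def x_def x'_def N_def)
  also have "\<dots> = (\<Sum>y\<in>{0..<N}. \<Sum>e\<in>E y. g e)"
    by (rule sum.UNION_disjoint) (auto simp: E_def)
  also have "\<dots> = (\<Sum>y\<in>{0..<N}.
      g (Cyc 1 y) + g (Cyc 2 y) + g (Cyc 3 y) + (g (Tri 1 2 y) + g (Tri 1 3 y) + g (Tri 2 3 y)))"
    by (simp add: E_def add.assoc)
  also have "\<dots> = (\<Sum>y\<in>{0..<N}. g (Cyc 1 y)) + (\<Sum>y\<in>{0..<N}. g (Cyc 2 y)) + (\<Sum>y\<in>{0..<N}. g (Cyc 3 y))
      + (\<Sum>y\<in>{0..<N}. g (Tri 1 2 y) + g (Tri 1 3 y) + g (Tri 2 3 y))"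
    by (simp only: sum.distrib)
  \<comment> \<open>Label x lies on two of the three triangle edges, and two different labels share
    exactly one.\<close>
  also have "(\<Sum>y\<in>{0..<N}. g (Tri 1 2 y) + g (Tri 1 3 y) + g (Tri 2 3 y)) =
      (\<Sum>y\<in>{0..<N}. if a = y then (if x = x' then 2 else - 1) * of_bool (a = b) else 0)"
    using x by (intro sum.cong) (auto simp: g_def)
  also have "\<dots> = (if x = x' then 2 else - 1) * of_bool (a = b)"
    using ab by simp
  finally have L: "?L $$ (i, j) =
      (if x = x' then w (Suc x) + 2 * of_bool (a = b) else - of_bool (a = b))"
    unfolding cyc using x by (auto simp: numeral_2_eq_2 numeral_3_eq_3)
  show "?L $$ (i, j) = ?R $$ (i, j)"
    unfolding L using i j n
    by (auto simp: three_block_mat_def delta_diag_def shift_pow_def x_def x'_def a_def b_def w_def N_def)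
qed (simp_all add: three_block_mat_def laplacian_mat_def degree_mat_def adjacency_mat_def
    length_delta_vertices)

section \<open>Elimination of the first block\<close>

lemma index_append_three:
  assumes dims: "dim_vec u = n" "dim_vec v = n" "dim_vec w = n" and i: "i < 3 * n"
  shows "(u @\<^sub>v v @\<^sub>v w) $ i =
    (if i div n = 0 then u else if i div n = 1 then v else w) $ (i mod n)"
proof -
  consider "i < n" | "n \<le> i" "i < 2 * n" | "2 * n \<le> i"
    by linarith
  then show ?thesis
  proof cases
    case 2
    then have "i div n = 1"
      by (intro div_nat_eqI) auto
    then show ?thesis
      using 2 dims minus_mult_div_eq_mod[of i n] by simp
  next
    case 3
    then have "i div n = 2"
      using i by (intro div_nat_eqI) auto
    then show ?thesis
      using 3 i dims minus_mult_div_eq_mod[of i n] by (auto simp: mult_2_right)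
  qed (simp add: dims)
qed

lemma three_block_mat_mult_vec:
  fixes X :: "nat \<Rightarrow> nat \<Rightarrow> 'a :: semiring_0 mat"
  assumes X: "\<And>x y. X x y \<in> carrier_mat n n"
    and p: "p \<in> carrier_vec n" "q \<in> carrier_vec n" "r \<in> carrier_vec n"
  shows "three_block_mat n X *\<^sub>v (p @\<^sub>v q @\<^sub>v r) =
    (X 0 0 *\<^sub>v p + (X 0 1 *\<^sub>v q + X 0 2 *\<^sub>v r)) @\<^sub>v
    (X 1 0 *\<^sub>v p + (X 1 1 *\<^sub>v q + X 1 2 *\<^sub>v r)) @\<^sub>v
    (X 2 0 *\<^sub>v p + (X 2 1 *\<^sub>v q + X 2 2 *\<^sub>v r))" (is "?l = ?r")
proof (rule eq_vecI)
  have dims: "dim_row (X x y) = n" "dim_col (X x y) = n" for x y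
    using X[of x y] by auto
  fix i assume "i < dim_vec ?r"
  then have i: "i < 3 * n"
    by (simp add: dims)
  then have n: "0 < n"
    by (cases n) auto
  have div3: "k div n = 0 \<or> k div n = 1 \<or> k div n = 2" if "k < 3 * n" for k
    using less_mult_imp_div_less[OF that] by linarith
  let ?x = "i div n" and ?i = "i mod n"
  \<comment> \<open>With the row cut into three block rows, the scalar product with (p, q, r) splits
    into three.\<close>
  have row: "row (three_block_mat n X) i = row (X ?x 0) ?i @\<^sub>v row (X ?x 1) ?i @\<^sub>v row (X ?x 2) ?i"
    (is "?u = ?w")
  proof (rule eq_vecI)
    fix j assume "j < dim_vec ?w"
    then have j: "j < 3 * n"
      by (simp add: dims)
    show "?u $ j = ?w $ j"
      using i j n div3[OF j] by (auto simp: index_append_three[of _ n] three_block_mat_def dims simp del: index_append_vec(1))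
  qed (simp add: dims three_block_mat_def)
  have "?l $ i = row (three_block_mat n X) i \<bullet> (p @\<^sub>v q @\<^sub>v r)"
    by (rule index_mult_mat_vec) (simp add: three_block_mat_def i)
  also have "\<dots> = row (X ?x 0) ?i \<bullet> p + (row (X ?x 1) ?i @\<^sub>v row (X ?x 2) ?i) \<bullet> (q @\<^sub>v r)"
    unfolding row using p
    by (intro scalar_prod_append[of _ n _ "n + n"]) (auto intro!: carrier_vecI simp: dims)
  also have "(row (X ?x 1) ?i @\<^sub>v row (X ?x 2) ?i) \<bullet> (q @\<^sub>v r) =
      row (X ?x 1) ?i \<bullet> q + row (X ?x 2) ?i \<bullet> r"
    using p by (intro scalar_prod_append[of _ n _ n]) (auto intro!: carrier_vecI simp: dims)
  also have "row (X ?x 0) ?i \<bullet> p + (row (X ?x 1) ?i \<bullet> q + row (X ?x 2) ?i \<bullet> r) = ?r $ i"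
    using div3[OF i] n by (auto simp: index_append_three[of _ n] i dims simp del: index_append_vec(1))
  finally show "?l $ i = ?r $ i" .
qed (use X in \<open>simp add: three_block_mat_def carrier_matD(1)[OF X]\<close>)

lemma vec_split_three:
  assumes "v \<in> carrier_vec (3 * n)"
  obtains p q r where "p \<in> carrier_vec n" "q \<in> carrier_vec n" "r \<in> carrier_vec n"
    "v = p @\<^sub>v q @\<^sub>v r"
proof
  let ?w = "vec_last v (n + n)"
  have "v = vec_first v n @\<^sub>v ?w"
    using assms by (intro vec_first_last_append[symmetric]) (simp add: mult_2 numeral_3_eq_3)
  also have "?w = vec_first ?w n @\<^sub>v vec_last ?w n"
    by (intro vec_first_last_append[symmetric] vec_last_carrier)
  finally show "v = vec_first v n @\<^sub>v vec_first ?w n @\<^sub>v vec_last ?w n" .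
qed simp_all

text \<open>The blocks are arbitrary integer matrices. The last block column of L is (-I, -I, D 2),
  and its invertible block -I allows the first coordinate block to be eliminated over the
  integers.\<close>

lemma coker_three_block_mat:
  fixes D :: "nat \<Rightarrow> int mat"
  assumes D: "\<And>x. D x \<in> carrier_mat n n"
  shows "coker (three_block_mat n (\<lambda>x y. if x = y then D x else - 1\<^sub>m n)) \<cong>
    coker (four_block_mat (- 1\<^sub>m n - D 0) (1\<^sub>m n + D 1) (- 1\<^sub>m n + D 2 * D 0) (- 1\<^sub>m n - D 2))"
    (is "coker ?L \<cong> coker ?M")
proof -
  have dims: "dim_row (D x) = n" "dim_col (D x) = n" for x
    using D[of x] by auto
  have L: "dim_row ?L = 3 * n" "dim_col ?L = 3 * n"
    by (simp_all add: three_block_mat_def)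
  have M: "dim_row ?M = n + n" "dim_col ?M = n + n"
    by (simp_all add: dims)
  have X: "(if x = y then D x else - 1\<^sub>m n) \<in> carrier_mat n n" for x y
    using D by simp
  have Lv: "?L *\<^sub>v (a @\<^sub>v b @\<^sub>v c) = (D 0 *\<^sub>v a - b - c) @\<^sub>v (D 1 *\<^sub>v b - a - c) @\<^sub>v (D 2 *\<^sub>v c - a - b)"
    if "a \<in> carrier_vec n" "b \<in> carrier_vec n" "c \<in> carrier_vec n" for a b c
  proof -
    have "D 0 *\<^sub>v a + (- b + - c) = D 0 *\<^sub>v a - b - c"
      "- a + (D 1 *\<^sub>v b + - c) = D 1 *\<^sub>v b - a - c"
      "- a + (- b + D 2 *\<^sub>v c) = D 2 *\<^sub>v c - a - b"
      using that D by (auto intro!: eq_vecI simp: dims)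
    then show ?thesis
      using three_block_mat_mult_vec[OF X that] that by simp
  qed
  have DD: "D 2 * D 0 \<in> carrier_mat n n"
    by (rule mult_carrier_mat[OF D D])
  have Mv: "?M *\<^sub>v (a @\<^sub>v b) =
      (b + D 1 *\<^sub>v b - a - D 0 *\<^sub>v a) @\<^sub>v (D 2 *\<^sub>v (D 0 *\<^sub>v a) - a - b - D 2 *\<^sub>v b)"
    if ab: "a \<in> carrier_vec n" "b \<in> carrier_vec n" for a b
  proof -
    have "?M *\<^sub>v (a @\<^sub>v b) = ((- 1\<^sub>m n - D 0) *\<^sub>v a + (1\<^sub>m n + D 1) *\<^sub>v b) @\<^sub>v
        ((- 1\<^sub>m n + D 2 * D 0) *\<^sub>v a + (- 1\<^sub>m n - D 2) *\<^sub>v b)"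
      using D by (intro four_block_mat_mult_vec[of _ n n _ n _ n]) (auto intro!: ab D minus_carrier_mat add_carrier_mat mult_carrier_mat[of _ n n])
    also have "(- 1\<^sub>m n - D 0) *\<^sub>v a = - a - D 0 *\<^sub>v a"
      using ab D by (subst minus_mult_distrib_mat_vec[of _ n n]) auto
    also have "(1\<^sub>m n + D 1) *\<^sub>v b = b + D 1 *\<^sub>v b"
      using ab D by (subst add_mult_distrib_mat_vec[of _ n n]) auto
    also have "(- 1\<^sub>m n + D 2 * D 0) *\<^sub>v a = - a + D 2 *\<^sub>v (D 0 *\<^sub>v a)"
      using ab DD by (subst add_mult_distrib_mat_vec[of _ n n]) (auto simp: assoc_mult_mat_vec[OF D D])
    also have "(- 1\<^sub>m n - D 2) *\<^sub>v b = - b - D 2 *\<^sub>v b"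
      using ab D by (subst minus_mult_distrib_mat_vec[of _ n n]) auto
    also have "- a - D 0 *\<^sub>v a + (b + D 1 *\<^sub>v b) = b + D 1 *\<^sub>v b - a - D 0 *\<^sub>v a"
      using ab by (auto intro!: eq_vecI simp: dims)
    also have "- a + D 2 *\<^sub>v (D 0 *\<^sub>v a) + (- b - D 2 *\<^sub>v b) =
        D 2 *\<^sub>v (D 0 *\<^sub>v a) - a - b - D 2 *\<^sub>v b"
      using ab by (auto intro!: eq_vecI simp: dims)
    finally show ?thesis .
  qed
  \<comment> \<open>Applied to L(a, b, c), whose first block is \<open>D 0\<close> a - b - c, the
    term -p cancels -c in the second block, and \<open>D 2\<close> p cancels \<open>D 2\<close> c in
    the third. It also produces the product \<open>D 2 * D 0\<close> in M.\<close>
  define f :: "int vec \<Rightarrow> int vec" where "f v =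
      (let p = vec_first v n; w = vec_last v (n + n)
       in (vec_first w n - p) @\<^sub>v (vec_last w n + D 2 *\<^sub>v p))" for v
  have f: "f (p @\<^sub>v q @\<^sub>v r) = (q - p) @\<^sub>v (r + D 2 *\<^sub>v p)"
    if "p \<in> carrier_vec n" "q \<in> carrier_vec n" "r \<in> carrier_vec n" for p q r
  proof -
    have "vec_first (p @\<^sub>v q @\<^sub>v r) n = p" "vec_last (p @\<^sub>v q @\<^sub>v r) (n + n) = q @\<^sub>v r"
      "vec_first (q @\<^sub>v r) n = q" "vec_last (q @\<^sub>v r) n = r"
      using that by (auto simp: vec_first_def vec_last_def intro!: eq_vecI)
    then show ?thesis
      by (simp add: f_def)
  qed
  \<comment> \<open>The result is independent of c. This gives one inclusion at once, and leaves c
    free for the converse.\<close>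
  have fL: "f (?L *\<^sub>v (a @\<^sub>v b @\<^sub>v c)) = ?M *\<^sub>v (a @\<^sub>v b)"
    if "a \<in> carrier_vec n" "b \<in> carrier_vec n" "c \<in> carrier_vec n" for a b c
  proof -
    have "D 2 *\<^sub>v (D 0 *\<^sub>v a - b - c) = D 2 *\<^sub>v (D 0 *\<^sub>v a) - D 2 *\<^sub>v b - D 2 *\<^sub>v c"
      using that D by (simp add: mult_minus_distrib_mat_vec[OF D] mult_mat_vec_carrier[OF D])
    then have "(D 1 *\<^sub>v b - a - c) - (D 0 *\<^sub>v a - b - c) = b + D 1 *\<^sub>v b - a - D 0 *\<^sub>v a"
      "(D 2 *\<^sub>v c - a - b) + D 2 *\<^sub>v (D 0 *\<^sub>v a - b - c) = D 2 *\<^sub>v (D 0 *\<^sub>v a) - a - b - D 2 *\<^sub>v b"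
      using that by (auto simp: dims intro!: eq_vecI)
    moreover have "f (?L *\<^sub>v (a @\<^sub>v b @\<^sub>v c)) = ((D 1 *\<^sub>v b - a - c) - (D 0 *\<^sub>v a - b - c)) @\<^sub>v
        ((D 2 *\<^sub>v c - a - b) + D 2 *\<^sub>v (D 0 *\<^sub>v a - b - c))"
      unfolding Lv[OF that]
      by (rule f) (use that in \<open>auto intro!: minus_carrier_vec mult_mat_vec_carrier[OF D]\<close>)
    ultimately show ?thesis
      by (simp only: Mv[OF that(1,2)])
  qed
  show ?thesis
  proof (rule coker_iso[of f])
    have "f (v + w) = f v + f w" if v: "v \<in> carrier_vec (3 * n)" and w: "w \<in> carrier_vec (3 * n)" for v w
    proof -
      obtain p q r where v: "p \<in> carrier_vec n" "q \<in> carrier_vec n" "r \<in> carrier_vec n" "v = p @\<^sub>v q @\<^sub>v r"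
        using vec_split_three[OF v] .
      obtain p' q' r' where w: "p' \<in> carrier_vec n" "q' \<in> carrier_vec n" "r' \<in> carrier_vec n"
        "w = p' @\<^sub>v q' @\<^sub>v r'"
        using vec_split_three[OF w] .
      have "v + w = (p + p') @\<^sub>v (q + q') @\<^sub>v (r + r')"
        using v w by (simp add: append_vec_add[of _ n _ _ "n + n"] append_vec_add[of _ n _ _ n])
      moreover have "f v + f w = ((q - p) + (q' - p')) @\<^sub>v ((r + D 2 *\<^sub>v p) + (r' + D 2 *\<^sub>v p'))"
        using v w D by (simp add: f append_vec_add[of _ n _ _ n] mult_mat_vec_carrier[OF D])
      moreover have "D 2 *\<^sub>v (p + p') = D 2 *\<^sub>v p + D 2 *\<^sub>v p'"
        using v w by (intro mult_add_distrib_mat_vec[OF D])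
      ultimately show ?thesis
        using v w by (auto simp: f dims intro!: eq_vecI arg_cong2[where f = append_vec])
    qed
    moreover have f_carrier: "f v \<in> carrier_vec (n + n)" for v
      by (auto simp: f_def Let_def dims intro!: carrier_vecI)
    ultimately show "f \<in> hom (monoid_vec TYPE(int) (dim_row ?L)) (monoid_vec TYPE(int) (dim_row ?M))"
      unfolding hom_def monoid_vec_simps L M by simp
    show "f ` carrier_vec (dim_row ?L) = carrier_vec (dim_row ?M)"
      unfolding L M
    proof (intro equalityI subsetI)
      fix u :: "int vec" assume u: "u \<in> carrier_vec (n + n)"
      let ?q = "vec_first u n" and ?r = "vec_last u n"
      \<comment> \<open>On vectors with p = 0, \<open>f\<close> merely drops the first block, which
        gives surjectivity.\<close>
      have "f (0\<^sub>v n @\<^sub>v ?q @\<^sub>v ?r) = ?q @\<^sub>v ?r"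
        using D by (subst f) (auto intro!: eq_vecI arg_cong2[where f = append_vec] simp: dims)
      also have "\<dots> = u"
        by (rule vec_first_last_append[OF u])
      finally show "u \<in> f ` carrier_vec (3 * n)"
        by (intro image_eqI[of _ _ "0\<^sub>v n @\<^sub>v ?q @\<^sub>v ?r"]) (auto intro!: carrier_vecI)
    qed (use f_carrier in blast)
    fix v :: "int vec" assume "v \<in> carrier_vec (dim_row ?L)"
    then have v: "v \<in> carrier_vec (3 * n)"
      by (simp only: L)
    show "f v \<in> mat_range ?M \<longleftrightarrow> v \<in> mat_range ?L"
    proof
      assume "v \<in> mat_range ?L"
      then obtain w where w: "w \<in> carrier_vec (3 * n)" "v = ?L *\<^sub>v w"
        unfolding mat_range_def L by blast
      obtain a b c where abc: "a \<in> carrier_vec n" "b \<in> carrier_vec n" "c \<in> carrier_vec n" "w = a @\<^sub>v b @\<^sub>v c"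
        using vec_split_three[OF w(1)] .
      have "f v = ?M *\<^sub>v (a @\<^sub>v b)"
        unfolding w(2) abc(4) by (rule fL[OF abc(1-3)])
      moreover have "a @\<^sub>v b \<in> carrier_vec (n + n)"
        using abc by simp
      ultimately show "f v \<in> mat_range ?M"
        unfolding mat_range_def M by blast
    next
      assume "f v \<in> mat_range ?M"
      then obtain u where u: "u \<in> carrier_vec (n + n)" "f v = ?M *\<^sub>v u"
        unfolding mat_range_def M by blast
      define a where "a = vec_first u n"
      define b where "b = vec_last u n"
      have ab: "a \<in> carrier_vec n" "b \<in> carrier_vec n" "u = a @\<^sub>v b"
        using vec_first_last_append[OF u(1)] by (simp_all add: a_def b_def)
      obtain p q r where pqr: "p \<in> carrier_vec n" "q \<in> carrier_vec n" "r \<in> carrier_vec n"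
        "v = p @\<^sub>v q @\<^sub>v r"
        using vec_split_three[OF v] .
      \<comment> \<open>Solves \<open>D 0\<close> a - b - c = p, so that L(a, b, c) has the same
        first block as v. Both vectors have the same image under \<open>f\<close>, and
        \<open>f\<close> is injective on vectors with a fixed first block, so they are
        equal.\<close>
      define c where "c = D 0 *\<^sub>v a - b - p"
      have c: "c \<in> carrier_vec n"
        using ab pqr by (simp add: c_def mult_mat_vec_carrier[OF D])
      define q' where "q' = D 1 *\<^sub>v b - a - c"
      define r' where "r' = D 2 *\<^sub>v c - a - b"
      have qr': "q' \<in> carrier_vec n" "r' \<in> carrier_vec n"
        using ab c by (simp_all add: q'_def r'_def mult_mat_vec_carrier[OF D])
      have "D 0 *\<^sub>v a - b - c = p"
        using ab pqr by (auto simp: c_def dims intro!: eq_vecI)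
      then have Lw: "?L *\<^sub>v (a @\<^sub>v b @\<^sub>v c) = p @\<^sub>v q' @\<^sub>v r'"
        by (simp only: Lv[OF ab(1,2) c] q'_def r'_def)
      have "f (p @\<^sub>v q' @\<^sub>v r') = f (p @\<^sub>v q @\<^sub>v r)"
        using fL[OF ab(1,2) c] u(2) by (simp only: Lw ab(3) pqr(4))
      then have "q' - p = q - p \<and> r' + D 2 *\<^sub>v p = r + D 2 *\<^sub>v p"
        using pqr qr' append_vec_eq[of "q' - p" n "q - p"] by (simp only: f minus_carrier_vec)
      then have "q' - p + p = q - p + p" "r' + D 2 *\<^sub>v p - D 2 *\<^sub>v p = r + D 2 *\<^sub>v p - D 2 *\<^sub>v p"
        by simp_all
      moreover have "x - p + p = x" "x + D 2 *\<^sub>v p - D 2 *\<^sub>v p = x" if "x \<in> carrier_vec n" for x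
        using that pqr by (auto simp: dims intro!: eq_vecI)
      ultimately have "q' = q" "r' = r"
        using qr' pqr by metis+
      then have "v = ?L *\<^sub>v (a @\<^sub>v b @\<^sub>v c)"
        by (simp only: Lw pqr(4))
      moreover have "a @\<^sub>v b @\<^sub>v c \<in> carrier_vec (3 * n)"
        using ab c by (auto intro!: carrier_vecI)
      ultimately show "v \<in> mat_range ?L"
        unfolding mat_range_def L by blast
    qed
  qed
qed

section \<open>From the graph to M: cokernels first, then their torsion subgroups\<close>

theorem theorem1:
  fixes n :: nat and k l m :: int and I T A B C M :: "int mat"
  assumes "n \<ge> 1"
    and "Gcd {k, l, m, int n} = 1"
    and "I = 1\<^sub>m n"
    and "T = shift_mat n"
    and "A = 4 \<cdot>\<^sub>m I - mat_int_pow n T k - mat_int_pow n T (- k)"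
    and "B = 4 \<cdot>\<^sub>m I - mat_int_pow n T l - mat_int_pow n T (- l)"
    and "C = 4 \<cdot>\<^sub>m I - mat_int_pow n T m - mat_int_pow n T (- m)"
    and "M = four_block_mat (- I - A) (I + B) (- I + C * A) (- I - C)"
  shows "jacobian (delta_graph n k l m) (delta_vertices n) \<cong> torsion_subgroup (coker M)"
proof -
  \<comment> \<open>Indices 0, 1, 2 stand for the labels 1, 2, 3, hence for the steps k, l,
    m.\<close>
  define D where "D x = delta_diag n (delta_step k l m (Suc x))" for x
  have "A = D 0" "B = D 1" "C = D 2"
    by (simp_all add: assms(3-7) mat_int_pow_shift D_def delta_diag_def delta_step_def)
  then have "coker (laplacian_mat (delta_graph n k l m) (delta_vertices n)) \<cong> coker M"
    unfolding assms(3,8) laplacian_delta_graph D_def[symmetric]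
    by (simp only:) (rule coker_three_block_mat, simp add: D_def delta_diag_carrier)
  then show ?thesis
    unfolding jacobian_def by (rule torsion_subgroup_iso[OF group_coker group_coker])
qed

end
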